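(* Fix any total budget $\mathrm{TB}\in\mathbb N_0$ and let $G$ be a game form. Suppose that Left has an optimal $0$-bid strategy in $(G,0)$. Then $G\ge 0$ if and only if $o(G,0)=\mathrm L$.
   Context: Game forms are defined recursively: $G=\{G^{\mathcal L}\mid G^{\mathcal R}\}$ where $G^{\mathcal L}$ (Left options) and $G^{\mathcal R}$ (Right options) are finite sets of game forms, and every game form has finite birthday (all play is finite). $0=\{\varnothing\mid\varnothing\}$. A follower of $G$ is any game form reachable from $G$ by a (possibly empty) sequence of moves of either player in any order. Fix a total budget $\mathrm{TB}\in\mathbb N_0$. The budget set is $\mathcal B=\{0,\dots,\mathrm{TB},\hat 0,\dots,\widehat{\mathrm{TB}}\}$: state $p$ (resp. $\hat p$) means Left holds $p$ dollars and Right holds $\mathrm{TB}-p$, and Right (resp. Left) holds the tie-breaking marker. A game $(G,\tilde p)$ is played as follows: at every position (terminal ones included) both players bid simultaneously, Left an integer $\ell$ with $0\le \ell\le p$, Right an integer $r$ with $0\le r\le \mathrm{TB}-p$. If Left holds the marker (state $\hat p$): if $\ell>r$ Left wins and moves to $(G^L,\widehat{p-\ell})$, or, including the marker in her payment (allowed when $\ell\ge r$), to $(G^L,p-\ell)$; if $\ell=r$ Left wins, the marker passes to Right, and play continues at $(G^L,p-\ell)$; if $\ell<r$ Right wins and moves to $(G^R,\widehat{p+r})$. Symmetrically when Right holds the marker (state $p$): if $r>\ell$ Right moves to $(G^R,p+r)$ or, including the marker, to $(G^R,\widehat{p+r})$; if $r=\ell$ Right wins, the marker passes to Left and play continues at $(G^R,\widehat{p+r})$;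 if $r<\ell$ Left moves to $(G^L,p-\ell)$. A player who wins a bid but has no option in the current game form loses. The partial outcome $o(G,\tilde p)\in\{\mathrm L,\mathrm R\}$ is the winner under optimal play (well defined via backward induction); $\mathrm L>\mathrm R$. Disjunctive sum: $G+H=\{G^{\mathcal L}+H,\,G+H^{\mathcal L}\mid G^{\mathcal R}+H,\,G+H^{\mathcal R}\}$. $G\ge H$ means: for every game form $X$ and every $\tilde p\in\mathcal B$, $o(G+X,\tilde p)\ge o(H+X,\tilde p)$. Left has an optimal $0$-bid strategy in $(G,\tilde p)$ if bidding $0$ is an optimal bid for Left at every follower position arising in play from $(G,\tilde p)$. *)

theory Defs
  imports "HOL-Library.FSet"
begin

text \<open>A game form is given by finite sets of Left and Right options; the
datatype is well-founded, so every game form has finite birthday.\<close>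

datatype game = Game (lopts: "game fset") (ropts: "game fset")

definition zero_game :: game where
  "zero_game = Game {||} {||}"

lemma game_size_lopt: "g |\<in>| A \<Longrightarrow> size g < size (Game A B)"
  by (induction A) (auto simp: fset_of_list.rep_eq)

lemma game_size_ropt: "g |\<in>| B \<Longrightarrow> size g < size (Game A B)"
  by (induction B) (auto simp: fset_of_list.rep_eq)

function gsum :: "game \<Rightarrow> game \<Rightarrow> game" where
  "gsum (Game GL GR) (Game HL HR) =
     Game ((\<lambda>g. gsum g (Game HL HR)) |`| GL |\<union>| (\<lambda>h. gsum (Game GL GR) h) |`| HL)
          ((\<lambda>g. gsum g (Game HL HR)) |`| GR |\<union>| (\<lambda>h. gsum (Game GL GR) h) |`| HR)"
  by pat_completeness auto
termination
  by (relation "measure (\<lambda>(g, h). size g + size h)")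
     (auto dest: game_size_lopt game_size_ropt)

text \<open>A budget state is a pair (p, m) with p \<le> TB: Left holds p dollars, Right
holds TB - p; m = True means Left holds the marker (state \<open>\<hat>p\<close>),
m = False means Right holds the marker (state p).\<close>

definition left_wins_bid :: "bool \<Rightarrow> nat \<Rightarrow> nat \<Rightarrow> bool" where
  "left_wins_bid m l r = (if m then r \<le> l else r < l)"

definition move :: "nat \<Rightarrow> nat \<Rightarrow> game \<Rightarrow> nat \<Rightarrow> bool \<Rightarrow> game \<Rightarrow> nat \<Rightarrow> bool \<Rightarrow> bool" where
  "move l r G p m G' p' m' \<longleftrightarrow>
     (m \<and> r < l \<and> G' |\<in>| lopts G \<and> p' = p - l)
   \<or> (m \<and> r = l \<and> G' |\<in>| lopts G \<and> p' = p - l \<and> \<not> m')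
   \<or> (m \<and> l < r \<and> G' |\<in>| ropts G \<and> p' = p + r \<and> m')
   \<or> (\<not> m \<and> l < r \<and> G' |\<in>| ropts G \<and> p' = p + r)
   \<or> (\<not> m \<and> r = l \<and> G' |\<in>| ropts G \<and> p' = p + r \<and> m')
   \<or> (\<not> m \<and> r < l \<and> G' |\<in>| lopts G \<and> p' = p - l \<and> \<not> m')"

text \<open>\<open>lwins TB G p m\<close>: the partial outcome o(G, p~) is L, i.e. Left has a bid
which wins against every Right bid (the winner of the bid then chooses
optimally among its moves; a bid winner without a move loses).\<close>
inductive lwins :: "nat \<Rightarrow> game \<Rightarrow> nat \<Rightarrow> bool \<Rightarrow> bool" for TB :: nat where
  "l \<le> p \<Longrightarrow>
   (\<forall>r. r \<le> TB - p \<longrightarrow>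
      (left_wins_bid m l r \<longrightarrow> (\<exists>G' p' m'. move l r G p m G' p' m' \<and> lwins TB G' p' m')) \<and>
      (\<not> left_wins_bid m l r \<longrightarrow> (\<forall>G' p' m'. move l r G p m G' p' m' \<longrightarrow> lwins TB G' p' m')))
   \<Longrightarrow> lwins TB G p m"

definition bid_wins :: "nat \<Rightarrow> nat \<Rightarrow> game \<Rightarrow> nat \<Rightarrow> bool \<Rightarrow> bool" where
  "bid_wins TB l G p m \<longleftrightarrow> l \<le> p \<and>
   (\<forall>r. r \<le> TB - p \<longrightarrow>
      (left_wins_bid m l r \<longrightarrow> (\<exists>G' p' m'. move l r G p m G' p' m' \<and> lwins TB G' p' m')) \<and>
      (\<not> left_wins_bid m l r \<longrightarrow> (\<forall>G' p' m'. move l r G p m G' p' m' \<longrightarrow> lwins TB G' p' m')))"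

datatype outcome = R | L

instantiation outcome :: linorder
begin
definition less_eq_outcome :: "outcome \<Rightarrow> outcome \<Rightarrow> bool" where
  "less_eq_outcome x y \<longleftrightarrow> x = R \<or> y = L"
definition less_outcome :: "outcome \<Rightarrow> outcome \<Rightarrow> bool" where
  "less_outcome x y \<longleftrightarrow> x = R \<and> y = L"
instance
  by standard (unfold less_eq_outcome_def less_outcome_def; metis outcome.exhaust outcome.distinct)+
end

definition outc :: "nat \<Rightarrow> game \<Rightarrow> nat \<Rightarrow> bool \<Rightarrow> outcome" where
  "outc TB G p m = (if lwins TB G p m then L else R)"

definition game_geq :: "nat \<Rightarrow> game \<Rightarrow> game \<Rightarrow> bool" where
  "game_geq TB G H \<longleftrightarrow>
     (\<forall>X p m. p \<le> TB \<longrightarrow> outc TB (gsum G X) p m \<ge> outc TB (gsum H X) p m)"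

inductive reach0 :: "nat \<Rightarrow> game \<Rightarrow> nat \<Rightarrow> bool \<Rightarrow> game \<Rightarrow> nat \<Rightarrow> bool \<Rightarrow> bool"
  for TB :: nat and G :: game and p :: nat and m :: bool where
  refl: "reach0 TB G p m G p m"
| step: "reach0 TB G p m H q k \<Longrightarrow> r \<le> TB - q \<Longrightarrow> move 0 r H q k H' q' k'
         \<Longrightarrow> reach0 TB G p m H' q' k'"

definition zero_bid_optimal :: "nat \<Rightarrow> game \<Rightarrow> nat \<Rightarrow> bool \<Rightarrow> bool" where
  "zero_bid_optimal TB G p m \<longleftrightarrow> (outc TB G p m = L \<longrightarrow> bid_wins TB 0 G p m)"

definition optimal_zero_bid_strategy :: "nat \<Rightarrow> game \<Rightarrow> nat \<Rightarrow> bool \<Rightarrow> bool" where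
  "optimal_zero_bid_strategy TB G p m \<longleftrightarrow>
     (\<forall>H q k. reach0 TB G p m H q k \<longrightarrow> zero_bid_optimal TB H q k)"

end

theory Submission
  imports Defs
begin

text \<open>
  Call a position of \<open>G\<close> safe if Left wins it by bidding \<open>0\<close> forever. For the nontrivial direction
  one shows that a safe position of \<open>G\<close> can be added to any position of \<open>X\<close> won by Left, adding up
  Left's budgets. Left plays her winning strategy of \<open>X\<close> until Right moves in \<open>G\<close>. In the critical
  case Right thereby hands over the marker and \<open>s \<ge> l\<close> dollars, where \<open>l\<close> was Left's bid. Left
  then bids \<open>s\<close>. If she wins, she answers in \<open>G\<close> and restores the budget that wins \<open>X\<close>. If Right
  outbids her and moves in \<open>X\<close>, then Left has at least one dollar more than the budget with which she
  already won that option of \<open>X\<close> when Right tied her bid \<open>l\<close>, and this dollar replaces the marker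
  that is missing when \<open>G\<close> and \<open>X\<close> both ask for one.
\<close>

section \<open>Disjunctive sums and the neutral game form\<close>

lemma lopts_gsum:
  "lopts (gsum G H) = (\<lambda>g. gsum g H) |`| lopts G |\<union>| gsum G |`| lopts H"
  by (cases G; cases H) simp

lemma ropts_gsum:
  "ropts (gsum G H) = (\<lambda>g. gsum g H) |`| ropts G |\<union>| gsum G |`| ropts H"
  by (cases G; cases H) simp

lemma size_lopts: "g |\<in>| lopts G \<Longrightarrow> size g < size G"
  by (cases G) (auto dest: game_size_lopt)

lemma size_ropts: "g |\<in>| ropts G \<Longrightarrow> size g < size G"
  by (cases G) (auto dest: game_size_ropt)

lemma gsum_zero_right: "gsum G zero_game = G"
proof (induction G)
  case (Game A B)
  have "(\<lambda>g. gsum g zero_game) |`| A = A" "(\<lambda>g. gsum g zero_game) |`| B = B"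
    using Game by (force simp: fset_eq_iff)+
  then show ?case by (simp add: zero_game_def)
qed

lemma gsum_zero_left: "gsum zero_game G = G"
proof (induction G)
  case (Game A B)
  have "gsum zero_game |`| A = A" "gsum zero_game |`| B = B"
    using Game by (force simp: fset_eq_iff)+
  then show ?case by (simp add: zero_game_def)
qed

section \<open>Winning bids, by the holder of the marker\<close>

lemma lwins_iff_bid_wins: "lwins TB G p m \<longleftrightarrow> (\<exists>l. bid_wins TB l G p m)"
  unfolding bid_wins_def by (subst lwins.simps) auto

text \<open>At a tie the marker must pass to Left. When Right bids strictly more, including it is
  his choice, hence the quantifier over \<open>m\<close>.\<close>

lemma bid_wins_False:
  "bid_wins TB l G p False \<longleftrightarrow> l \<le> p \<and>
     (\<forall>r \<le> TB - p.
       (r < l \<longrightarrow> (\<exists>H. H |\<in>| lopts G \<and> lwins TB H (p - l) False)) \<and>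
       (r = l \<longrightarrow> (\<forall>H. H |\<in>| ropts G \<longrightarrow> lwins TB H (p + r) True)) \<and>
       (l < r \<longrightarrow> (\<forall>H m. H |\<in>| ropts G \<longrightarrow> lwins TB H (p + r) m)))"
  unfolding bid_wins_def
  apply (rule conj_cong[OF HOL.refl], rule all_cong1, rule imp_cong[OF HOL.refl])
  subgoal for r by (cases r l rule: linorder_cases) (auto simp: left_wins_bid_def move_def)
  done

lemma bid_wins_True:
  "bid_wins TB l G p True \<longleftrightarrow> l \<le> p \<and>
     (\<forall>r \<le> TB - p.
       (r < l \<longrightarrow> (\<exists>H m. H |\<in>| lopts G \<and> lwins TB H (p - l) m)) \<and>
       (r = l \<longrightarrow> (\<exists>H. H |\<in>| lopts G \<and> lwins TB H (p - l) False)) \<and>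
       (l < r \<longrightarrow> (\<forall>H. H |\<in>| ropts G \<longrightarrow> lwins TB H (p + r) True)))"
  unfolding bid_wins_def
  apply (rule conj_cong[OF HOL.refl], rule all_cong1, rule imp_cong[OF HOL.refl])
  subgoal for r by (cases r l rule: linorder_cases) (auto simp: left_wins_bid_def move_def)
  done

text \<open>A bid of \<open>0\<close> never beats the holder of the marker, so Right has to move and
  has no option.\<close>

lemma lwins_zero_game: "lwins TB zero_game p False"
proof -
  have "bid_wins TB 0 zero_game p False"
    by (simp add: bid_wins_False zero_game_def)
  then show ?thesis
    by (subst lwins_iff_bid_wins) blast
qed

section \<open>Safe positions: trading dollars and the marker\<close>

text \<open>Optimality is stripped away here, so that budgets can be varied freely. Bidding
  \<open>0\<close>, Left never loses a dollar; she wins a bid only with the marker and against a bid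
  of \<open>0\<close>, which is why just the second rule asks for a Left option \<open>H0\<close>,
  and without the marker.\<close>

inductive safe :: "nat \<Rightarrow> game \<Rightarrow> nat \<Rightarrow> bool \<Rightarrow> bool" for TB :: nat where
  safe_False:
    "(\<And>H. H |\<in>| ropts G \<Longrightarrow> safe TB H q True) \<Longrightarrow>
     (\<And>H r m. H |\<in>| ropts G \<Longrightarrow> 0 < r \<Longrightarrow> q + r \<le> TB \<Longrightarrow> safe TB H (q + r) m) \<Longrightarrow>
     safe TB G q False"
| safe_True:
    "H0 |\<in>| lopts G \<Longrightarrow> safe TB H0 q False \<Longrightarrow>
     (\<And>H r. H |\<in>| ropts G \<Longrightarrow> 0 < r \<Longrightarrow> q + r \<le> TB \<Longrightarrow> safe TB H (q + r) True) \<Longrightarrow>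
     safe TB G q True"

lemma safe_False_ropt:
  "safe TB G q False \<Longrightarrow> H |\<in>| ropts G \<Longrightarrow> safe TB H q True"
  by (erule safe.cases) auto

lemma safe_False_ropt_paid:
  "safe TB G q False \<Longrightarrow> H |\<in>| ropts G \<Longrightarrow> 0 < r \<Longrightarrow> q + r \<le> TB \<Longrightarrow> safe TB H (q + r) m"
  by (erule safe.cases) auto

lemma safe_True_lopt:
  assumes "safe TB G q True"
  obtains H where "H |\<in>| lopts G" "safe TB H q False"
  using assms by cases (auto intro: that)

lemma safe_True_ropt_paid:
  "safe TB G q True \<Longrightarrow> H |\<in>| ropts G \<Longrightarrow> 0 < r \<Longrightarrow> q + r \<le> TB \<Longrightarrow> safe TB H (q + r) True"
  by (erule safe.cases) auto

text \<open>An extra dollar for Left leaves Right fewer bids, and each position reached has that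
  extra dollar too.\<close>

lemma safe_Suc:
  "safe TB G q m \<Longrightarrow> Suc q \<le> TB \<Longrightarrow> safe TB G (Suc q) m"
proof (induction rule: safe.induct)
  case (safe_False G q)
  show ?case
  proof (rule safe.safe_False)
    fix H r m
    assume "H |\<in>| ropts G" "0 < r" "Suc q + r \<le> TB"
    then show "safe TB H (Suc q + r) m"
      using safe_False.IH(2)[of H r m] by simp
  qed (use safe_False in auto)
next
  case (safe_True H0 G q)
  show ?case
  proof (rule safe.safe_True)
    fix H r
    assume "H |\<in>| ropts G" "0 < r" "Suc q + r \<le> TB"
    then show "safe TB H (Suc q + r) True"
      using safe_True.IH(2)[of H r] by simp
  qed (use safe_True in auto)
qed

lemma safe_mono:
  assumes "safe TB G q m" "q \<le> q'" "q' \<le> TB"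
  shows "safe TB G q' m"
  using assms(2,3)
proof (induction q' rule: dec_induct)
  case base
  show ?case by (rule assms(1))
next
  case (step n)
  then show ?case using safe_Suc by simp
qed

text \<open>Without the marker Left never has to move, so only Right's moves matter. Afterwards Left
  either has both the marker and the dollar, or exchanges again by induction.\<close>

lemma safe_dollar_for_marker:
  "safe TB G q True \<Longrightarrow> Suc q \<le> TB \<Longrightarrow> safe TB G (Suc q) False"
proof (induction G arbitrary: q rule: measure_induct_rule[of size])
  case (less G)
  show ?case
  proof (rule safe.safe_False)
    fix H assume "H |\<in>| ropts G"
    then show "safe TB H (Suc q) True"
      \<comment> \<open>A tie at \<open>0\<close> from \<open>Suc q\<close> leads to the same state
        as a bid of \<open>1\<close> from \<open>q\<close> with Left holding the marker.\<close>
      using safe_True_ropt_paid[OF less.prems(1), of H 1] less.prems(2) by simp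
  next
    fix H r m assume H: "H |\<in>| ropts G" "0 < r" "Suc q + r \<le> TB"
    have 1: "safe TB H (q + r) True"
      using safe_True_ropt_paid[OF less.prems(1)] H by simp
    show "safe TB H (Suc q + r) m"
      using less.IH[OF size_ropts[OF H(1)] 1] safe_Suc[OF 1] H(3) by (cases m) auto
  qed
qed

section \<open>From optimal zero bids to safety\<close>

lemma reach0_trans:
  assumes "reach0 TB H q k H' q' k'" "reach0 TB G p m H q k"
  shows "reach0 TB G p m H' q' k'"
  using assms by (induction rule: reach0.induct) (auto intro: reach0.step)

lemma optimal_zero_bid_strategy_move:
  assumes "optimal_zero_bid_strategy TB G p m" "r \<le> TB - p" "move 0 r G p m G' p' m'"
  shows "optimal_zero_bid_strategy TB G' p' m'"
proof -
  have "reach0 TB G p m G' p' m'"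
    using reach0.step[OF reach0.refl assms(2,3)] .
  then show ?thesis
    using assms(1) reach0_trans unfolding optimal_zero_bid_strategy_def by blast
qed

text \<open>Induction on the game form: the bid \<open>0\<close> wins now, and the strategy
  hypothesis passes to every position that a move against this bid can reach.\<close>

lemma safe_if_optimal_zero_bid_strategy:
  assumes "optimal_zero_bid_strategy TB G p m" "lwins TB G p m"
  shows "safe TB G p m"
  using assms
proof (induction G arbitrary: p m rule: measure_induct_rule[of size])
  case (less G)
  have bid: "bid_wins TB 0 G p m"
    using less.prems reach0.refl
    unfolding optimal_zero_bid_strategy_def zero_bid_optimal_def outc_def by auto
  have child: "safe TB G' p' m'"
    if "r \<le> TB - p" "move 0 r G p m G' p' m'" "lwins TB G' p' m'" for r G' p' m'
  proof -
    have "size G' < size G"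
      using that(2) by (auto simp: move_def dest: size_lopts size_ropts)
    then show ?thesis
      using less.IH optimal_zero_bid_strategy_move[OF less.prems(1)] that by blast
  qed
  show ?case
  proof (cases m)
    case True
    then have m: "m = True" by simp
    from bid obtain H where H: "H |\<in>| lopts G" "lwins TB H p False"
      unfolding m bid_wins_True by auto
    from H have "safe TB H p False"
      using child[of 0 H p False] True by (auto simp: move_def)
    moreover have "safe TB H (p + r) True" if "H |\<in>| ropts G" "0 < r" "p + r \<le> TB" for H r
      using child[of r H "p + r" True] bid that True by (auto simp: move_def bid_wins_True)
    ultimately show ?thesis
      unfolding m by (rule safe.safe_True[OF H(1)])
  next
    case False
    then have m: "m = False" by simp
    show ?thesis
      unfolding m
    proof (rule safe.safe_False)
      fix H assume "H |\<in>| ropts G"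
      then show "safe TB H p True"
        using child[of 0 H p True] bid m by (auto simp: move_def bid_wins_False)
    next
      fix H r m' assume "H |\<in>| ropts G" "0 < r" "p + r \<le> TB"
      then show "safe TB H (p + r) m'"
        using child[of r H "p + r" m'] bid m by (auto simp: move_def bid_wins_False)
    qed
  qed
qed

section \<open>Adding a safe position to a won one\<close>

text \<open>
  The second conjunct fails for \<open>s < l\<close>: a safe marker position of \<open>G\<close> need not be compatible with
  every bid of Left in \<open>X\<close>. The spare dollar in the third conjunct is needed as well.
\<close>

lemma lwins_gsum_safe_aux:
  "(safe TB G a False \<longrightarrow> lwins TB X b m \<longrightarrow> a + b \<le> TB \<longrightarrow> lwins TB (gsum G X) (a + b) m) \<and>
   (safe TB G a True \<longrightarrow> bid_wins TB l X b False \<longrightarrow> l \<le> s \<longrightarrow> a + s + b \<le> TB \<longrightarrow>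
      lwins TB (gsum G X) (a + s + b) True) \<and>
   (safe TB G a True \<longrightarrow> lwins TB X b True \<longrightarrow> Suc (a + b) \<le> TB \<longrightarrow>
      lwins TB (gsum G X) (Suc (a + b)) True)"
proof (induction "size G + size X" arbitrary: G X a b m l s rule: less_induct)
  case less
  have base: "lwins TB (gsum G' X') p m"
    if "size G' + size X' < size G + size X" "safe TB G' a' False" "lwins TB X' b' m"
      "p = a' + b'" "p \<le> TB" for G' X' a' b' m p
    using less[OF that(1), of a' b' m 0 0] that(2-) by simp
  \<comment> \<open>All dollars beyond \<open>a' + b'\<close> play the role of
    \<open>s\<close>.\<close>
  have one_marker: "lwins TB (gsum G' X') p True"
    if "size G' + size X' < size G + size X" "safe TB G' a' True" "bid_wins TB l X' b' False"
      "a' + l + b' \<le> p" "p \<le> TB" for G' X' a' b' l p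
    using less[OF that(1), of a' b' False l "p - a' - b'"] that(2-) by simp
  \<comment> \<open>Surplus dollars go to the budget of \<open>G'\<close> by
    \<open>safe_mono\<close>, except one, the spare dollar.\<close>
  have two_markers: "lwins TB (gsum G' X') p True"
    if "size G' + size X' < size G + size X" "safe TB G' a' True" "lwins TB X' b' True"
      "Suc (a' + b') \<le> p" "p \<le> TB" for G' X' a' b' p
    using less[OF that(1), of "p - Suc b'" b' False 0 0] safe_mono[OF that(2), of "p - Suc b'"] that(3-)
    by simp
  note size = size_lopts size_ropts
  have 1: "lwins TB (gsum G X) (a + b) m"
    if safe: "safe TB G a False" and X: "lwins TB X b m" and TB: "a + b \<le> TB"
  proof -
    from X obtain l where l: "bid_wins TB l X b m"
      by (auto simp: lwins_iff_bid_wins)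
    have lb: "l \<le> b" using l by (simp add: bid_wins_def)
    have lopt: "lwins TB (gsum G H) (a + b - l) m'"
      if "H |\<in>| lopts X" "lwins TB H (b - l) m'" for H m'
      using that TB lb by (intro base[where a' = a and b' = "b - l"] safe) (auto dest: size)
    have ropt: "lwins TB (gsum G H) (a + b + r) m'"
      if "H |\<in>| ropts X" "lwins TB H (b + r) m'" "r \<le> TB - (a + b)" for H m' r
      using that TB by (intro base[where a' = a and b' = "b + r"] safe) (auto dest: size)
    \<comment> \<open>Dollars paid by Right in \<open>G\<close> are credited to \<open>G\<close>;
      the state of \<open>X\<close> stays untouched.\<close>
    have paid: "lwins TB (gsum H X) (a + b + r) m"
      if "H |\<in>| ropts G" "0 < r" "r \<le> TB - (a + b)" for H r
      using that TB X
      by (intro base[where a' = "a + r" and b' = b] safe_False_ropt_paid[OF safe]) (auto dest: size)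
    have "bid_wins TB l (gsum G X) (a + b) m"
    proof (cases m)
      case True
      then have m: "m = True" by simp
      note l = l[unfolded m bid_wins_True] and paid = paid[unfolded m]
      show ?thesis
        unfolding m bid_wins_True
      proof (intro conjI allI impI)
        fix r assume r: "r \<le> TB - (a + b)"
        then have "r \<le> TB - b" by simp
        note lr = l[THEN conjunct2, THEN spec, THEN mp, OF this]
        show "\<exists>H m. H |\<in>| lopts (gsum G X) \<and> lwins TB H (a + b - l) m" if "r < l"
          using lr lopt that unfolding lopts_gsum by blast
        show "\<exists>H. H |\<in>| lopts (gsum G X) \<and> lwins TB H (a + b - l) False" if "r = l"
          using lr lopt that unfolding lopts_gsum by blast
        show "lwins TB H (a + b + r) True" if "l < r" "H |\<in>| ropts (gsum G X)" for H
          using lr ropt[OF _ _ r] paid[OF _ _ r] that unfolding ropts_gsum by auto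
      qed (use lb in simp)
    next
      case False
      then have m: "m = False" by simp
      \<comment> \<open>The critical case: \<open>G\<close> now needs the marker, and the
        \<open>r\<close> dollars received cover the bid \<open>l\<close>.\<close>
      have marker: "lwins TB (gsum H X) (a + b + r) True"
        if "H |\<in>| ropts G" "l \<le> r" "r \<le> TB - (a + b)" for H r
        using that TB l m
        by (intro one_marker[where a' = a and b' = b and l = l] safe_False_ropt[OF safe])
          (auto dest: size)
      have paid_any: "lwins TB (gsum H X) (a + b + r) m'"
        if "H |\<in>| ropts G" "l < r" "r \<le> TB - (a + b)" for H r m'
        using that paid[of H r] marker[of H r] m by (cases m') auto
      note l = l[unfolded m bid_wins_False]
      show ?thesis
        unfolding m bid_wins_False
      proof (intro conjI allI impI)
        fix r assume r: "r \<le> TB - (a + b)"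
        then have "r \<le> TB - b" by simp
        note lr = l[THEN conjunct2, THEN spec, THEN mp, OF this]
        show "\<exists>H. H |\<in>| lopts (gsum G X) \<and> lwins TB H (a + b - l) False" if "r < l"
          using lr[THEN conjunct1] lopt that unfolding lopts_gsum by blast
        show "lwins TB H (a + b + r) True" if "r = l" "H |\<in>| ropts (gsum G X)" for H
          using lr[THEN conjunct2, THEN conjunct1] ropt[OF _ _ r] marker[OF _ _ r] that
          unfolding ropts_gsum by auto
        show "lwins TB H (a + b + r) m'" if "l < r" "H |\<in>| ropts (gsum G X)" for H m'
          using lr[THEN conjunct2, THEN conjunct2] ropt[OF _ _ r] paid_any[OF _ _ r] that
          unfolding ropts_gsum by auto
      qed (use lb in simp)
    qed
    then show ?thesis by (auto simp: lwins_iff_bid_wins)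
  qed
  have 2: "lwins TB (gsum G X) (a + s + b) True"
    if safe: "safe TB G a True" and l: "bid_wins TB l X b False" and s: "l \<le> s"
      and TB: "a + s + b \<le> TB"
  proof -
    have X: "lwins TB X b False" using l by (auto simp: lwins_iff_bid_wins)
    obtain K where K: "K |\<in>| lopts G" "safe TB K a False"
      using safe by (rule safe_True_lopt)
    \<comment> \<open>Left gives the marker away with her bid \<open>s\<close>: by force at a tie,
      by choice if she bids strictly more.\<close>
    have lopt: "lwins TB (gsum K X) (a + s + b - s) False"
      using TB X K by (intro base[where a' = a and b' = b]) (auto dest: size)
    have ropt: "lwins TB (gsum G H) (a + s + b + r) True"
      if H: "H |\<in>| ropts X" and r: "s < r" "r \<le> TB - (a + s + b)" for H r
    proof -
      \<comment> \<open>This is Right's tying bid \<open>l\<close> in \<open>X\<close>. As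
        \<open>r > s\<close> and \<open>s \<ge> l\<close>, the actual budget exceeds
        \<open>a + (b + l)\<close> by at least the spare dollar.\<close>
      have "lwins TB H (b + l) True"
        using l[unfolded bid_wins_False, THEN conjunct2, THEN spec, of l] H r s by simp
      then show ?thesis
        using H r s TB by (intro two_markers[where a' = a and b' = "b + l"] safe) (auto dest: size)
    qed
    \<comment> \<open>The payment \<open>r\<close> is credited to \<open>G\<close>, so
      \<open>s\<close> is still there to cover \<open>l\<close>.\<close>
    have paid: "lwins TB (gsum H X) (a + s + b + r) True"
      if "H |\<in>| ropts G" "s < r" "r \<le> TB - (a + s + b)" for H r
      using that TB l s
      by (intro one_marker[where a' = "a + r" and b' = b and l = l] safe_True_ropt_paid[OF safe])
        (auto dest: size)
    have "bid_wins TB s (gsum G X) (a + s + b) True"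
      unfolding bid_wins_True
    proof (intro conjI allI impI)
      fix r assume r: "r \<le> TB - (a + s + b)"
      show "\<exists>H m. H |\<in>| lopts (gsum G X) \<and> lwins TB H (a + s + b - s) m"
        using lopt K(1) unfolding lopts_gsum by blast
      show "\<exists>H. H |\<in>| lopts (gsum G X) \<and> lwins TB H (a + s + b - s) False"
        using lopt K(1) unfolding lopts_gsum by blast
      show "lwins TB H (a + s + b + r) True" if "s < r" "H |\<in>| ropts (gsum G X)" for H
        using ropt[OF _ _ r] paid[OF _ _ r] that unfolding ropts_gsum by auto
    qed simp
    then show ?thesis by (auto simp: lwins_iff_bid_wins)
  qed
  have 3: "lwins TB (gsum G X) (Suc (a + b)) True"
    if safe: "safe TB G a True" and X: "lwins TB X b True" and TB: "Suc (a + b) \<le> TB"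
  proof -
    from X obtain l where l: "bid_wins TB l X b True"
      by (auto simp: lwins_iff_bid_wins)
    have lb: "l \<le> b" using l by (simp add: bid_wins_def)
    \<comment> \<open>When Left moves in \<open>X\<close>, the spare dollar is traded for the marker
      of \<open>G\<close>, and \<open>X\<close> alone decides about the real one. After moves of
      Right the spare dollar is kept.\<close>
    have safe': "safe TB G (Suc a) False"
      using safe TB by (intro safe_dollar_for_marker) auto
    have lopt: "lwins TB (gsum G H) (Suc (a + b) - l) m'"
      if "H |\<in>| lopts X" "lwins TB H (b - l) m'" for H m'
      using that TB lb
      by (intro base[where a' = "Suc a" and b' = "b - l"] safe') (auto dest: size)
    have ropt: "lwins TB (gsum G H) (Suc (a + b) + r) True"
      if "H |\<in>| ropts X" "lwins TB H (b + r) True" "r \<le> TB - Suc (a + b)" for H r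
      using that TB by (intro two_markers[where a' = a and b' = "b + r"] safe) (auto dest: size)
    have paid: "lwins TB (gsum H X) (Suc (a + b) + r) True"
      if "H |\<in>| ropts G" "0 < r" "r \<le> TB - Suc (a + b)" for H r
      using that TB X
      by (intro two_markers[where a' = "a + r" and b' = b] safe_True_ropt_paid[OF safe])
        (auto dest: size)
    have "bid_wins TB l (gsum G X) (Suc (a + b)) True"
      unfolding bid_wins_True
    proof (intro conjI allI impI)
      fix r assume r: "r \<le> TB - Suc (a + b)"
      then have "r \<le> TB - b" by simp
      note lr = l[unfolded bid_wins_True, THEN conjunct2, THEN spec, THEN mp, OF this]
      show "\<exists>H m. H |\<in>| lopts (gsum G X) \<and> lwins TB H (Suc (a + b) - l) m" if "r < l"
        using lr lopt that unfolding lopts_gsum by blast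
      show "\<exists>H. H |\<in>| lopts (gsum G X) \<and> lwins TB H (Suc (a + b) - l) False" if "r = l"
        using lr lopt that unfolding lopts_gsum by blast
      show "lwins TB H (Suc (a + b) + r) True" if "l < r" "H |\<in>| ropts (gsum G X)" for H
        using lr ropt[OF _ _ r] paid[OF _ _ r] that unfolding ropts_gsum by auto
    qed (use lb in simp)
    then show ?thesis by (auto simp: lwins_iff_bid_wins)
  qed
  show ?case using 1 2 3 by blast
qed

lemma lwins_gsum_safe:
  assumes "safe TB G a False" "lwins TB X b m" "a + b \<le> TB"
  shows "lwins TB (gsum G X) (a + b) m"
  using lwins_gsum_safe_aux[of TB G a X b m 0 0] assms by simp

theorem mainTheorem1:
  fixes TB :: nat and G :: game
  assumes "optimal_zero_bid_strategy TB G 0 False"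
  shows "game_geq TB G zero_game \<longleftrightarrow> outc TB G 0 False = L"
proof
  assume "game_geq TB G zero_game"
  \<comment> \<open>The test form \<open>X\<close> is \<open>0\<close> itself, in the state
    \<open>0\<close>.\<close>
  then have "outc TB (gsum zero_game zero_game) 0 False \<le> outc TB (gsum G zero_game) 0 False"
    unfolding game_geq_def by blast
  then show "outc TB G 0 False = L"
    by (simp add: gsum_zero_right outc_def lwins_zero_game less_eq_outcome_def)
next
  assume "outc TB G 0 False = L"
  then have "lwins TB G 0 False"
    by (simp add: outc_def split: if_splits)
  then have "safe TB G 0 False"
    by (rule safe_if_optimal_zero_bid_strategy[OF assms])
  \<comment> \<open>Safety with budget \<open>0\<close> lets \<open>X\<close> keep all of Left's
    \<open>p\<close> dollars.\<close>
  then have "lwins TB (gsum G X) p m" if "lwins TB X p m" "p \<le> TB" for X p m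
    using lwins_gsum_safe[of TB G 0 X p m] that by simp
  then show "game_geq TB G zero_game"
    unfolding game_geq_def gsum_zero_left outc_def less_eq_outcome_def by presburger
qed

end
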